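(* Let $(\sigma_k)_{k\ge1}$ be real numbers with $0\le\sigma_k\le\sigma_{k-1}$ for all $k\geq 2$. Let $z_0\in\mathbb R^{n_2}$ and, for $k\ge1$, let $(y_k,z_k,\lambda_k)\in\mathbb R^{n_1}\times\mathbb R^{n_2}\times\mathbb R^m$ be the sequence generated by the partial proximal point method, i.e. $(y_k,z_k,\lambda_k)$ is an approximate KKT solution of $\min\{f(y)+g(z)+\frac{\sigma_k}{2}\|z-z_{k-1}\|^2: By+Cz=b\}$ in the sense that, with error terms $(\epsilon_k^1,\epsilon_k^2,\epsilon_k^3)\in\mathbb R^{n_1}\times\mathbb R^{n_2}\times\mathbb R^m$, $$\epsilon_k^1\in\partial f(y_k)+B^\top\lambda_k,\qquad \epsilon_k^2\in\partial g(z_k)+C^\top\lambda_k+\sigma_k(z_k-z_{k-1}),\qquad \epsilon_k^3=By_k+Cz_k-b.$$ Suppose that $\sum_{k=1}^\infty(1+\|y_k\|)\|\epsilon_k^1\|<\infty$, $\sum_{k=1}^\infty(1+\|z_k\|)\|\epsilon_k^2\|<\infty$ and $\sum_{k=1}^\infty(1+\|\lambda_k\|)\|\epsilon_k^3\|<\infty$. Then, with $x_k=(y_k,z_k)$, $$\lim_{k\to\infty}\max\left\{\mathrm{dist}(0,\partial f(y_k)+B^\top\lambda_k),\ \mathrm{dist}(0,\partial g(z_k)+C^\top\lambda_k),\ \|\mathcal A x_k-b\|,\ |\mathcal F(x_k)-\mathcal F(x^* )|\right\}=0,$$ where $x^*$ is an optimal solution of $\min\{f(y)+g(z): By+Cz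=b\}$.
   Context: Problem: $\min\{f(y)+g(z): By+Cz=b\}$, where $B\in\mathbb R^{m\times n_1}$, $C\in\mathbb R^{m\times n_2}$, $b\in\mathbb R^m$, and $f:\mathbb R^{n_1}\to(-\infty,\infty]$, $g:\mathbb R^{n_2}\to(-\infty,\infty]$ are proper, lower semicontinuous and convex (no strong convexity is assumed). Notation: $x=(y,z)$, $\mathcal F(x)=f(y)+g(z)$, $\mathcal A x=By+Cz$, $\|\cdot\|$ is the Euclidean norm, $\mathrm{dist}(0,S)=\inf_{s\in S}\|s\|$. A triple $(y,z,\lambda)$ is a KKT solution of the problem if $0\in\partial f(y)+B^\top\lambda$, $0\in\partial g(z)+C^\top\lambda$ and $By+Cz-b=0$. The set of KKT solutions is assumed nonempty. *)

theory Defs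
  imports "HOL-Analysis.Analysis"
begin

text \<open>Extended-valued functions \<open>f : \<real>\<^sup>n \<rightarrow> (-\<infinity>, \<infinity>]\<close> are modelled with codomain \<^typ>\<open>ereal\<close>;
  properness excludes the value \<open>-\<infinity>\<close>.\<close>

definition proper_fun :: "('a \<Rightarrow> ereal) \<Rightarrow> bool" where
  "proper_fun f \<longleftrightarrow> (\<forall>x. f x \<noteq> -\<infinity>) \<and> (\<exists>x. f x \<noteq> \<infinity>)"

definition lsc_fun :: "('a::topological_space \<Rightarrow> ereal) \<Rightarrow> bool" where
  "lsc_fun f \<longleftrightarrow> (\<forall>x. f x \<le> Liminf (at x) f)"

text \<open>For a function without the value \<open>-\<infinity>\<close>, the \<^typ>\<open>ereal\<close> convention \<open>0 * \<infinity> = 0\<close> makes the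
  boundary cases \<open>u = 0\<close> and \<open>v = 0\<close> hold automatically.\<close>

definition convex_fun :: "('a::real_vector \<Rightarrow> ereal) \<Rightarrow> bool" where
  "convex_fun f \<longleftrightarrow> (\<forall>x y. \<forall>u\<ge>0. \<forall>v\<ge>0. u + v = 1 \<longrightarrow>
     f (u *\<^sub>R x + v *\<^sub>R y) \<le> ereal u * f x + ereal v * f y)"

text \<open>The subdifferential is empty at points where the function is not finite.\<close>

definition subdifferential :: "('a::real_inner \<Rightarrow> ereal) \<Rightarrow> 'a \<Rightarrow> 'a set" where
  "subdifferential f x =
     {v. \<bar>f x\<bar> \<noteq> \<infinity> \<and> (\<forall>u. f x + ereal (v \<bullet> (u - x)) \<le> f u)}"

text \<open>The distance is \<^typ>\<open>ereal\<close>-valued so that the distance to the empty set is \<open>\<infinity>\<close>;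
  \<^const>\<open>infdist\<close> would give \<open>0\<close>.\<close>

definition dist0 :: "'a::real_normed_vector set \<Rightarrow> ereal" where
  "dist0 S = (INF s\<in>S. ereal (norm s))"

definition objective :: "('a \<Rightarrow> ereal) \<Rightarrow> ('b \<Rightarrow> ereal) \<Rightarrow> 'a \<times> 'b \<Rightarrow> ereal" where
  "objective f g x = f (fst x) + g (snd x)"

definition constraint_map ::
    "real^'n1^'m \<Rightarrow> real^'n2^'m \<Rightarrow> (real^'n1) \<times> (real^'n2) \<Rightarrow> real^'m" where
  "constraint_map B C x = B *v fst x + C *v snd x"

definition optimal_solution ::
    "(real^'n1 \<Rightarrow> ereal) \<Rightarrow> (real^'n2 \<Rightarrow> ereal) \<Rightarrow> real^'n1^'m \<Rightarrow> real^'n2^'m \<Rightarrow> real^'m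
      \<Rightarrow> (real^'n1) \<times> (real^'n2) \<Rightarrow> bool" where
  "optimal_solution f g B C b x \<longleftrightarrow>
     constraint_map B C x = b \<and>
     (\<forall>x'. constraint_map B C x' = b \<longrightarrow> objective f g x \<le> objective f g x')"

text \<open>In the KKT conditions, \<open>a +o S\<close> is the translate \<open>{a + s | s \<in> S}\<close>.\<close>

definition KKT_solutions ::
    "(real^'n1 \<Rightarrow> ereal) \<Rightarrow> (real^'n2 \<Rightarrow> ereal) \<Rightarrow> real^'n1^'m \<Rightarrow> real^'n2^'m \<Rightarrow> real^'m
      \<Rightarrow> ((real^'n1) \<times> (real^'n2) \<times> (real^'m)) set" where
  "KKT_solutions f g B C b = {(y, z, l).
     0 \<in> (transpose B *v l) +o subdifferential f y \<and>
     0 \<in> (transpose C *v l) +o subdifferential g z \<and>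
     B *v y + C *v z - b = 0}"

end

theory Submission
  imports Defs
begin

text \<open>
  Fix a KKT solution \<open>(y\<^sup>*, z\<^sup>*, \<lambda>\<^sup>*)\<close> and write \<open>x\<^sup>* = (y\<^sup>*, z\<^sup>*)\<close>,
  \<open>\<Delta>\<^sub>k = z\<^sub>k - z\<^sub>k\<^sub>-\<^sub>1\<close>. Everything follows from two subgradient inequalities for
  \<open>F(y, z) = f y + g z\<close>. The subgradient at \<open>x\<^sup>*\<close> (lemma \<open>KKT_lower_bound\<close>) gives
  \<open>F(x\<^sup>*) - \<lambda>\<^sup>* \<bullet> \<epsilon>\<^sub>k\<^sup>3 \<le> F(x\<^sub>k)\<close>, and the one at \<open>x\<^sub>k\<close> (lemma \<open>proximal_upper_bound\<close>) gives
  \<open>F(x\<^sub>k) \<le> F(x\<^sup>*) + \<dots> - \<sigma>\<^sub>k \<Delta>\<^sub>k \<bullet> (z\<^sub>k - z\<^sup>*)\<close>, where the dots stand for products of the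
  errors with the iterates or with the KKT point; these are summable by hypothesis.

  Adding the two inequalities eliminates \<open>F\<close> and leaves an upper bound, with summable right-hand
  side, on \<open>2 \<sigma>\<^sub>k \<Delta>\<^sub>k \<bullet> (z\<^sub>k - z\<^sup>*) =
  \<sigma>\<^sub>k (\<parallel>z\<^sub>k - z\<^sup>*\<parallel>\<^sup>2 - \<parallel>z\<^sub>k\<^sub>-\<^sub>1 - z\<^sup>*\<parallel>\<^sup>2 + \<parallel>\<Delta>\<^sub>k\<parallel>\<^sup>2)\<close>. Since \<open>\<sigma>\<close> is
  nonincreasing, the quantities \<open>\<sigma>\<^sub>k\<^sub>+\<^sub>1 \<parallel>z\<^sub>k - z\<^sup>*\<parallel>\<^sup>2\<close> form a quasi-Fejer sequence (lemma
  \<open>quasi_Fejer\<close>). So they stay bounded, and \<open>\<sigma>\<^sub>k \<parallel>\<Delta>\<^sub>k\<parallel>\<^sup>2\<close> is summable, hence tends to \<open>0\<close>.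
  Feeding this back into the same inequality shows that \<open>\<sigma>\<^sub>k \<parallel>z\<^sub>k - z\<^sup>*\<parallel>\<^sup>2\<close> is bounded as well.

  The iterates themselves may be unbounded, but only two weighted products matter, and both vanish
  (lemma \<open>weighted_steps_vanish\<close>). First, \<open>\<sigma>\<^sub>k \<parallel>\<Delta>\<^sub>k\<parallel> \<rightarrow> 0\<close> because \<open>\<sigma>\<close> is bounded; this is
  the amount by which the proximal term spoils the dual residual. Second,
  \<open>\<sigma>\<^sub>k \<parallel>\<Delta>\<^sub>k\<parallel> \<parallel>z\<^sub>k - z\<^sup>*\<parallel> \<rightarrow> 0\<close>, as the product of \<open>\<surd>\<sigma>\<^sub>k \<parallel>\<Delta>\<^sub>k\<parallel> \<rightarrow> 0\<close> with the bounded
  \<open>\<surd>\<sigma>\<^sub>k \<parallel>z\<^sub>k - z\<^sup>*\<parallel>\<close>; this closes the gap between the two bounds on \<open>F(x\<^sub>k)\<close>.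
\<close>

section \<open>Subgradient bounds on the objective\<close>

lemma dist0_nonneg: "0 \<le> dist0 S"
  unfolding dist0_def by (rule INF_greatest) simp

lemma dist0_le: "s \<in> S \<Longrightarrow> dist0 S \<le> ereal (norm s)"
  unfolding dist0_def by (rule INF_lower)

lemma separable_subgradient_inequality:
  fixes f :: "'a::real_inner \<Rightarrow> ereal" and g :: "'b::real_inner \<Rightarrow> ereal"
  assumes "v \<in> subdifferential f y" "w \<in> subdifferential g z"
  shows "objective f g (y, z) + ereal (v \<bullet> (y' - y) + w \<bullet> (z' - z)) \<le> objective f g (y', z')"
proof -
  have "f y + ereal (v \<bullet> (y' - y)) \<le> f y'" "g z + ereal (w \<bullet> (z' - z)) \<le> g z'"
    using assms by (auto simp: subdifferential_def)
  then have "(f y + ereal (v \<bullet> (y' - y))) + (g z + ereal (w \<bullet> (z' - z))) \<le> f y' + g z'"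
    by (rule add_mono)
  then show ?thesis
    by (simp add: objective_def ac_simps flip: plus_ereal.simps(1))
qed

lemma objective_finite:
  assumes "v \<in> subdifferential f y" "w \<in> subdifferential g z"
  obtains r where "objective f g (y, z) = ereal r"
  using assms unfolding subdifferential_def objective_def
  by (cases "f y"; cases "g z") auto

text \<open>\<open>-B\<^sup>T\<lambda>\<^sup>*\<close> and \<open>-C\<^sup>T\<lambda>\<^sup>*\<close> are subgradients at the KKT point. As that point is feasible, their
  pairing with a displacement only sees the constraint residual where the displacement ends.\<close>

lemma KKT_lower_bound:
  fixes B :: "real^'n1^'m" and C :: "real^'n2^'m"
  assumes "(ys, zs, ls) \<in> KKT_solutions f g B C b"
  shows "objective f g (ys, zs) + ereal (- (ls \<bullet> (B *v y + C *v z - b))) \<le> objective f g (y, z)"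
proof -
  have sub: "- (transpose B *v ls) \<in> subdifferential f ys"
      "- (transpose C *v ls) \<in> subdifferential g zs"
    and b: "b = B *v ys + C *v zs"
    using assms by (auto simp: KKT_solutions_def simp flip: set_minus_plus)
  have "- (transpose B *v ls) \<bullet> (y - ys) + - (transpose C *v ls) \<bullet> (z - zs)
      = - (ls \<bullet> (B *v y + C *v z - b))"
    unfolding b by (simp add: dot_lmul_matrix matrix_vector_mult_diff_distrib
        inner_diff_right inner_add_right)
  then show ?thesis
    using separable_subgradient_inequality[OF sub, of y z] by simp
qed

text \<open>All optimal solutions share the value of a KKT point, so the comparison with an arbitrary
  optimal solution reduces to the comparison with the KKT point.\<close>

lemma optimal_value_eq_KKT_value:
  fixes B :: "real^'n1^'m" and C :: "real^'n2^'m"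
  assumes kkt: "(ys, zs, ls) \<in> KKT_solutions f g B C b"
    and opt: "optimal_solution f g B C b x"
  shows "objective f g x = objective f g (ys, zs)"
proof (rule antisym)
  show "objective f g x \<le> objective f g (ys, zs)"
    using kkt opt by (simp add: optimal_solution_def KKT_solutions_def constraint_map_def)
  have "B *v fst x + C *v snd x - b = 0"
    using opt by (simp add: optimal_solution_def constraint_map_def)
  then show "objective f g (ys, zs) \<le> objective f g x"
    using KKT_lower_bound[OF kkt, of "fst x" "snd x"] by (simp flip: zero_ereal_def)
qed

text \<open>The subgradient inequality at an approximate solution of the proximal subproblem, evaluated at
  a feasible point; \<open>p\<close> is the proximal term \<open>\<sigma>\<^sub>k (z\<^sub>k - z\<^sub>k\<^sub>-\<^sub>1)\<close>.\<close>

lemma proximal_upper_bound: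
  fixes B :: "real^'n1^'m" and C :: "real^'n2^'m"
  assumes "d1 \<in> (transpose B *v l) +o subdifferential f y"
    and "d2 \<in> (transpose C *v l + p) +o subdifferential g z"
    and feas: "B *v ys + C *v zs = b"
  shows "objective f g (y, z)
      + ereal (l \<bullet> (B *v y + C *v z - b) - d1 \<bullet> (y - ys) - d2 \<bullet> (z - zs) + p \<bullet> (z - zs))
      \<le> objective f g (ys, zs)"
proof -
  have sub: "d1 - transpose B *v l \<in> subdifferential f y"
      "d2 - (transpose C *v l + p) \<in> subdifferential g z"
    using assms by (auto simp flip: set_minus_plus)
  have "(d1 - transpose B *v l) \<bullet> (ys - y) + (d2 - (transpose C *v l + p)) \<bullet> (zs - z)
      = l \<bullet> (B *v y + C *v z - b) - d1 \<bullet> (y - ys) - d2 \<bullet> (z - zs) + p \<bullet> (z - zs)"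
    unfolding feas[symmetric]
    by (simp add: dot_lmul_matrix algebra_simps
        inner_diff_left inner_diff_right inner_add_left inner_add_right)
  then show ?thesis
    using separable_subgradient_inequality[OF sub, of ys zs] by simp
qed

section \<open>Quasi-Fejer monotonicity of the weighted distances\<close>

lemma quasi_Fejer:
  fixes a p d :: "nat \<Rightarrow> real"
  assumes step: "\<And>k. a (Suc k) + p k \<le> a k + d k"
    and nonneg: "\<And>k. 0 \<le> a k" "\<And>k. 0 \<le> p k" "\<And>k. 0 \<le> d k"
    and d: "summable d"
  shows "\<exists>M. \<forall>k. a k \<le> M" and "summable p"
proof -
  have telescoped: "a n + (\<Sum>k<n. p k) \<le> a 0 + (\<Sum>k<n. d k)" for n
  proof (induction n)
    case (Suc n)
    then show ?case using step[of n] by simp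
  qed simp
  have bound: "a n + (\<Sum>k<n. p k) \<le> a 0 + suminf d" for n
    using telescoped[of n] sum_le_suminf[OF d, of "{..<n}"] nonneg(3) by simp
  have "a n \<le> a 0 + suminf d" for n
    using bound[of n] sum_nonneg[of "{..<n}" p] nonneg(2) by simp
  then show "\<exists>M. \<forall>k. a k \<le> M" by blast
  show "summable p"
    using bound nonneg by (intro summableI_nonneg_bounded[where x = "a 0 + suminf d"])
      (auto intro: order_trans[OF le_add_same_cancel2[THEN iffD2]])
qed

text \<open>An affine change of the weight is harmless because \<open>\<parallel>x - c\<parallel> \<le> (1 + \<parallel>c\<parallel>) (1 + \<parallel>x\<parallel>)\<close>.\<close>

lemma summable_norm_weighted:
  fixes x :: "nat \<Rightarrow> 'a::real_normed_vector" and d :: "nat \<Rightarrow> 'b::real_normed_vector"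
  assumes "summable (\<lambda>k. (1 + norm (x k)) * norm (d k))"
  shows "summable (\<lambda>k. norm (d k) * norm (x k - c))"
proof (rule summable_comparison_test'[OF summable_mult[OF assms, of "1 + norm c"]])
  fix k :: nat
  have "norm (x k - c) \<le> norm (x k) + norm c"
    by (rule norm_triangle_ineq4)
  also have "\<dots> \<le> (1 + norm c) * (1 + norm (x k))"
    by (simp add: algebra_simps)
  finally show "norm (norm (d k) * norm (x k - c))
      \<le> (1 + norm c) * ((1 + norm (x k)) * norm (d k))"
    by (simp add: mult_left_mono mult.commute mult.left_commute)
qed

lemma summable_norm_of_weighted:
  fixes x :: "nat \<Rightarrow> 'a::real_normed_vector" and d :: "nat \<Rightarrow> 'b::real_normed_vector"
  assumes "summable (\<lambda>k. (1 + norm (x k)) * norm (d k))"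
  shows "summable (\<lambda>k. norm (d k))"
  by (rule summable_comparison_test'[OF assms]) (simp add: algebra_simps)

text \<open>The three-point identity turns the hypothesis on \<open>(z (Suc k) - z k) \<bullet> (z (Suc k) - c)\<close> into a
  decrease of the squared distance to \<open>c\<close>, up to \<open>2 * d k\<close> and with weight \<open>s k\<close> on both the old
  and the new distance. Lowering the weight of the new one to \<open>s (Suc k)\<close> makes it a quasi-Fejer
  inequality.\<close>

lemma weighted_steps_vanish:
  fixes z :: "nat \<Rightarrow> 'a::real_inner" and s d :: "nat \<Rightarrow> real"
  assumes s: "\<And>k. 0 \<le> s k" "\<And>k. s (Suc k) \<le> s k"
    and d: "summable d" "\<And>k. 0 \<le> d k"
    and ineq: "\<And>k. s k * ((z (Suc k) - z k) \<bullet> (z (Suc k) - c)) \<le> d k"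
  shows "(\<lambda>k. s k * norm (z (Suc k) - z k)) \<longlonglongrightarrow> 0"
    and "(\<lambda>k. s k * norm (z (Suc k) - z k) * norm (z (Suc k) - c)) \<longlonglongrightarrow> 0"
proof -
  define a where "a k = s k * (norm (z k - c))\<^sup>2" for k
  define p where "p k = s k * (norm (z (Suc k) - z k))\<^sup>2" for k
  define q where "q k = s k * (norm (z (Suc k) - c))\<^sup>2" for k
  have three_point: "q k + p k \<le> a k + 2 * d k" for k
  proof -
    have "2 * ((z (Suc k) - z k) \<bullet> (z (Suc k) - c))
        = (norm (z (Suc k) - c))\<^sup>2 - (norm (z k - c))\<^sup>2 + (norm (z (Suc k) - z k))\<^sup>2"
      by (simp add: power2_norm_eq_inner inner_diff_left inner_diff_right inner_commute)
    then have "q k - a k + p k = 2 * (s k * ((z (Suc k) - z k) \<bullet> (z (Suc k) - c)))"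
      by (simp add: a_def p_def q_def mult.left_commute[of 2] ring_distribs)
    with ineq[of k] show ?thesis by linarith
  qed
  have step: "a (Suc k) + p k \<le> a k + 2 * d k" for k
  proof -
    have "a (Suc k) \<le> q k"
      unfolding a_def q_def using s(2) by (simp add: mult_right_mono)
    with three_point[of k] show ?thesis by linarith
  qed
  have nonneg: "0 \<le> a k" "0 \<le> p k" for k
    unfolding a_def p_def using s(1) by simp_all
  have sum_2d: "summable (\<lambda>k. 2 * d k)" "\<And>k. 0 \<le> 2 * d k"
    using d by (simp_all add: summable_mult)
  note fejer = quasi_Fejer[where a = a and p = p, OF step nonneg sum_2d(2) sum_2d(1)]
  obtain M where M: "a k \<le> M" for k
    using fejer(1) by auto
  have "summable p"
    by (rule fejer(2))
  then have p0: "p \<longlonglongrightarrow> 0"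
    by (rule summable_LIMSEQ_zero)
  have s_le: "s k \<le> s 0" for k
    using s(2) by (induction k) (auto intro: order_trans)
  have d_le: "d k \<le> suminf d" for k
    using sum_le_suminf[OF d(1), of "{k}"] d(2) by simp
  \<comment> \<open>The bound on \<open>a\<close> is not enough: \<open>q k\<close> measures the same distance as \<open>a (Suc k)\<close>, but with
    the larger weight \<open>s k\<close>.\<close>
  have q_le: "q k \<le> M + 2 * suminf d" for k
    using three_point[of k] M[of k] d_le[of k] nonneg(2)[of k] by linarith
  have root_p0: "(\<lambda>k. sqrt (p k)) \<longlonglongrightarrow> 0"
    using tendsto_real_sqrt[OF p0] by simp
  have root_p: "sqrt (p k) = sqrt (s k) * norm (z (Suc k) - z k)"
    and root_q: "sqrt (q k) = sqrt (s k) * norm (z (Suc k) - c)" for k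
    by (simp_all add: p_def q_def real_sqrt_mult)
  have root_s: "sqrt (s k) * sqrt (s k) = s k" for k
    using s(1) by simp
  show "(\<lambda>k. s k * norm (z (Suc k) - z k)) \<longlonglongrightarrow> 0"
  proof (rule tendsto_sandwich[OF _ _ tendsto_const])
    show "(\<lambda>k. sqrt (s 0) * sqrt (p k)) \<longlonglongrightarrow> 0"
      using tendsto_mult_right_zero[OF root_p0] .
    have "s k * norm (z (Suc k) - z k) = sqrt (s k) * sqrt (p k)" for k
      unfolding root_p by (simp only: root_s flip: mult.assoc)
    then show "\<forall>\<^sub>F k in sequentially. s k * norm (z (Suc k) - z k) \<le> sqrt (s 0) * sqrt (p k)"
      using s_le nonneg by (simp add: mult_right_mono)
  qed (use s(1) in simp)
  show "(\<lambda>k. s k * norm (z (Suc k) - z k) * norm (z (Suc k) - c)) \<longlonglongrightarrow> 0"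
  proof (rule tendsto_sandwich[OF _ _ tendsto_const])
    show "(\<lambda>k. sqrt (M + 2 * suminf d) * sqrt (p k)) \<longlonglongrightarrow> 0"
      using tendsto_mult_right_zero[OF root_p0] .
    have "s k * norm (z (Suc k) - z k) * norm (z (Suc k) - c) = sqrt (q k) * sqrt (p k)" for k
      unfolding root_p root_q using s(1)[of k] by (subst root_s[symmetric]) (simp add: ac_simps)
    then show "\<forall>\<^sub>F k in sequentially. s k * norm (z (Suc k) - z k) * norm (z (Suc k) - c)
        \<le> sqrt (M + 2 * suminf d) * sqrt (p k)"
      using q_le nonneg by (simp add: mult_right_mono)
  qed (use s(1) in simp)
qed

section \<open>Convergence of the optimality residuals\<close>

theorem theorem4p1:
  fixes f :: "real^'n1 \<Rightarrow> ereal" and g :: "real^'n2 \<Rightarrow> ereal"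
    and B :: "real^'n1^'m" and C :: "real^'n2^'m" and b :: "real^'m"
    and \<sigma> :: "nat \<Rightarrow> real"
    and y :: "nat \<Rightarrow> real^'n1" and z :: "nat \<Rightarrow> real^'n2" and l :: "nat \<Rightarrow> real^'m"
    and e1 :: "nat \<Rightarrow> real^'n1" and e2 :: "nat \<Rightarrow> real^'n2" and e3 :: "nat \<Rightarrow> real^'m"
    and z0 :: "real^'n2" and xstar :: "(real^'n1) \<times> (real^'n2)"
  assumes f: "proper_fun f" "lsc_fun f" "convex_fun f"
    and g: "proper_fun g" "lsc_fun g" "convex_fun g"
    and KKT: "KKT_solutions f g B C b \<noteq> {}"
    and \<sigma>: "\<And>k. k \<ge> 2 \<Longrightarrow> 0 \<le> \<sigma> k \<and> \<sigma> k \<le> \<sigma> (k - 1)"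
    and z_0: "z 0 = z0"
    and e1: "\<And>k. k \<ge> 1 \<Longrightarrow> e1 k \<in> (transpose B *v l k) +o subdifferential f (y k)"
    and e2: "\<And>k. k \<ge> 1 \<Longrightarrow>
      e2 k \<in> (transpose C *v l k + \<sigma> k *\<^sub>R (z k - z (k - 1))) +o subdifferential g (z k)"
    and e3: "\<And>k. k \<ge> 1 \<Longrightarrow> e3 k = B *v y k + C *v z k - b"
    and sum1: "summable (\<lambda>k. (1 + norm (y (Suc k))) * norm (e1 (Suc k)))"
    and sum2: "summable (\<lambda>k. (1 + norm (z (Suc k))) * norm (e2 (Suc k)))"
    and sum3: "summable (\<lambda>k. (1 + norm (l (Suc k))) * norm (e3 (Suc k)))"
    and xstar: "optimal_solution f g B C b xstar"
  shows "(\<lambda>k. Max {dist0 ((transpose B *v l k) +o subdifferential f (y k)),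
                   dist0 ((transpose C *v l k) +o subdifferential g (z k)),
                   ereal (norm (constraint_map B C (y k, z k) - b)),
                   \<bar>objective f g (y k, z k) - objective f g xstar\<bar>})
         \<longlonglongrightarrow> 0"
proof -
  obtain ys zs ls where kkt: "(ys, zs, ls) \<in> KKT_solutions f g B C b"
    using KKT by auto
  have feas: "B *v ys + C *v zs = b"
    using kkt by (simp add: KKT_solutions_def)
  have "- (transpose B *v ls) \<in> subdifferential f ys" "- (transpose C *v ls) \<in> subdifferential g zs"
    using kkt by (auto simp: KKT_solutions_def simp flip: set_minus_plus)
  then obtain opt where opt: "objective f g (ys, zs) = ereal opt"
    by (rule objective_finite)
  have opt': "objective f g xstar = ereal opt"
    using optimal_value_eq_KKT_value[OF kkt xstar] opt by simp
  have "\<exists>r. objective f g (y (Suc k), z (Suc k)) = ereal r" for k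
    using e1[of "Suc k"] e2[of "Suc k"] objective_finite
    by (metis One_nat_def Suc_le_mono le0 set_minus_plus)
  then obtain val where val: "objective f g (y (Suc k), z (Suc k)) = ereal (val k)" for k
    by metis

  \<comment> \<open>The proximal step is only defined from index 1 on, so all sequences are shifted by one.\<close>
  define s where "s k = \<sigma> (Suc k)" for k
  define \<Delta> where "\<Delta> k = z (Suc k) - z k" for k
  have s: "0 \<le> s k" "s (Suc k) \<le> s k" for k
    using \<sigma>[of "Suc (Suc k)"] unfolding s_def by auto

  have lower: "opt - ls \<bullet> e3 (Suc k) \<le> val k" for k
    using KKT_lower_bound[OF kkt, of "y (Suc k)" "z (Suc k)"] by (simp add: opt val e3)
  have upper: "val k + l (Suc k) \<bullet> e3 (Suc k) - e1 (Suc k) \<bullet> (y (Suc k) - ys)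
      - e2 (Suc k) \<bullet> (z (Suc k) - zs) + s k * (\<Delta> k \<bullet> (z (Suc k) - zs)) \<le> opt" for k
    using proximal_upper_bound[OF e1 e2 feas, of "Suc k"] by (simp add: opt val e3 s_def \<Delta>_def)

  \<comment> \<open>The weighted summability hypotheses bound the first three terms, with centres \<open>ys\<close>, \<open>zs\<close> and
    \<open>0\<close>; the last term is the error in the lower bound.\<close>
  define d where "d k = norm (e1 (Suc k)) * norm (y (Suc k) - ys)
    + norm (e2 (Suc k)) * norm (z (Suc k) - zs) + norm (e3 (Suc k)) * norm (l (Suc k) - 0)
    + norm ls * norm (e3 (Suc k))" for k
  have sum_e: "summable (\<lambda>k. norm (e1 (Suc k)))" "summable (\<lambda>k. norm (e2 (Suc k)))"
      "summable (\<lambda>k. norm (e3 (Suc k)))"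
    using sum1 sum2 sum3 by (auto intro: summable_norm_of_weighted)
  have sum_d: "summable d"
    unfolding d_def
    by (intro summable_add summable_norm_weighted summable_mult sum1 sum2 sum3 sum_e)
  have d_nonneg: "0 \<le> d k" for k
    by (simp add: d_def)
  have errors: "e1 (Suc k) \<bullet> (y (Suc k) - ys) + e2 (Suc k) \<bullet> (z (Suc k) - zs)
      - l (Suc k) \<bullet> e3 (Suc k) + \<bar>ls \<bullet> e3 (Suc k)\<bar> \<le> d k" for k
    using norm_cauchy_schwarz[of "e1 (Suc k)" "y (Suc k) - ys"]
      norm_cauchy_schwarz[of "e2 (Suc k)" "z (Suc k) - zs"]
      Cauchy_Schwarz_ineq2[of "l (Suc k)" "e3 (Suc k)"]
      Cauchy_Schwarz_ineq2[of ls "e3 (Suc k)"]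
    unfolding d_def by (simp add: mult.commute)
  have prox_ineq: "s k * (\<Delta> k \<bullet> (z (Suc k) - zs)) \<le> d k" for k
    using lower[of k] upper[of k] errors[of k] by linarith
  note vanish = weighted_steps_vanish[OF s sum_d d_nonneg prox_ineq[unfolded \<Delta>_def],
      folded \<Delta>_def]

  have gap: "\<bar>val k - opt\<bar> \<le> d k + s k * norm (\<Delta> k) * norm (z (Suc k) - zs)" for k
  proof -
    have "\<bar>s k * (\<Delta> k \<bullet> (z (Suc k) - zs))\<bar> \<le> s k * norm (\<Delta> k) * norm (z (Suc k) - zs)"
      using s(1)[of k] Cauchy_Schwarz_ineq2[of "\<Delta> k" "z (Suc k) - zs"]
      by (simp add: abs_mult mult.assoc mult_left_mono)
    moreover have "\<bar>ls \<bullet> e3 (Suc k)\<bar> \<le> d k"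
      using Cauchy_Schwarz_ineq2[of ls "e3 (Suc k)"] by (simp add: d_def add_increasing)
    ultimately show ?thesis
      using lower[of k] upper[of k] errors[of k] by linarith
  qed

  define r where "r k = norm (e1 (Suc k)) + (norm (e2 (Suc k)) + s k * norm (\<Delta> k))
    + norm (e3 (Suc k)) + (d k + s k * norm (\<Delta> k) * norm (z (Suc k) - zs))" for k
  have "r \<longlonglongrightarrow> 0 + (0 + 0) + 0 + (0 + 0)"
    unfolding r_def
    by (intro tendsto_add vanish summable_LIMSEQ_zero[OF sum_d] sum_e[THEN summable_LIMSEQ_zero])
  then have r_lim: "(\<lambda>k. ereal (r k)) \<longlonglongrightarrow> 0"
    by (simp add: zero_ereal_def)
  have parts: "0 \<le> s k * norm (\<Delta> k)" "0 \<le> s k * norm (\<Delta> k) * norm (z (Suc k) - zs)" for k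
    using s(1) by simp_all

  have res1: "dist0 ((transpose B *v l (Suc k)) +o subdifferential f (y (Suc k))) \<le> ereal (r k)"
    for k
  proof -
    have "norm (e1 (Suc k)) \<le> r k"
      using parts[of k] d_nonneg[of k] by (simp add: r_def)
    then show ?thesis
      using dist0_le[OF e1[of "Suc k"]] by (auto intro: order_trans)
  qed
  have res2: "dist0 ((transpose C *v l (Suc k)) +o subdifferential g (z (Suc k))) \<le> ereal (r k)"
    for k
  proof -
    have "e2 (Suc k) - s k *\<^sub>R \<Delta> k \<in> (transpose C *v l (Suc k)) +o subdifferential g (z (Suc k))"
      using e2[of "Suc k"] by (simp add: s_def \<Delta>_def algebra_simps flip: set_minus_plus)
    moreover have "norm (e2 (Suc k) - s k *\<^sub>R \<Delta> k) \<le> r k"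
      using norm_triangle_ineq4[of "e2 (Suc k)" "s k *\<^sub>R \<Delta> k"] parts[of k] d_nonneg[of k] s(1)[of k]
        norm_ge_zero[of "e1 (Suc k)"] norm_ge_zero[of "e3 (Suc k)"]
      unfolding r_def norm_scaleR by linarith
    ultimately show ?thesis
      using dist0_le by (meson ereal_less_eq(3) order_trans)
  qed
  have res3: "norm (constraint_map B C (y (Suc k), z (Suc k)) - b) \<le> r k" for k
    using parts[of k] d_nonneg[of k] by (simp add: r_def constraint_map_def e3[symmetric])
  have res4: "\<bar>objective f g (y (Suc k), z (Suc k)) - objective f g xstar\<bar> \<le> ereal (r k)" for k
    using gap[of k] parts(1)[of k] norm_ge_zero[of "e1 (Suc k)"] norm_ge_zero[of "e2 (Suc k)"]
      norm_ge_zero[of "e3 (Suc k)"]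
    unfolding val opt' r_def ereal_minus(1) abs_ereal.simps(1) ereal_less_eq(3) by linarith

  show ?thesis
  proof (rule LIMSEQ_imp_Suc, rule tendsto_sandwich[OF _ _ tendsto_const r_lim])
  qed (use res1 res2 res3 res4 in \<open>simp_all add: le_max_iff_disj dist0_nonneg\<close>)
qed

end
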